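(* Let $n,m,\nu\in\mathbb{N}$, let $0=r_0<r_1<\cdots<r_\nu$, and put $\mathcal{I}_i=[-r_i,-r_{i-1}]$ for $i\in\mathbb{N}_\nu:=\{1,\dots,\nu\}$. For each $i\in\mathbb{N}_\nu$ let $\widetilde{A}_i:\mathcal{I}_i\to\mathbb{R}^{n\times n}$ and $\widetilde{C}_i:\mathcal{I}_i\to\mathbb{R}^{m\times n}$ be matrix-valued functions. Then $$\widetilde{A}_i(\cdot)\in L^2(\mathcal{I}_i;\mathbb{R}^{n\times n})\quad\text{and}\quad \widetilde{C}_i(\cdot)\in L^2(\mathcal{I}_i;\mathbb{R}^{m\times n})\qquad\text{for all } i\in\mathbb{N}_\nu$$ if and only if for all $i\in\mathbb{N}_\nu$ there exist $d_i\in\mathbb{N}$ and $\delta_i,\mu_i\in\mathbb{N}_0=\mathbb{N}\cup\{0\}$, functions $\boldsymbol{f}_i\in H^1(\mathcal{I}_i;\mathbb{R}^{d_i})$, $\boldsymbol{\varphi}_i\in L^2(\mathcal{I}_i;\mathbb{R}^{\delta_i})$, $\boldsymbol{\phi}_i\in L^2(\mathcal{I}_i;\mathbb{R}^{\mu_i})$, and constant matrices $M_i\in\mathbb{R}^{d_i\times\varkappa_i}$, $\widehat{A}_i\in\mathbb{R}^{n\times\kappa_i n}$, $\widehat{C}_i\in\mathbb{R}^{m\times\kappa_i n}$, where $\varkappa_i=d_i+\delta_i$ and $\kappa_i=d_i+\delta_i+\mu_i$, such that, with $$\boldsymbol{h}_i(\tau)=\begin{bmatrix}\boldsymbol{\varphi}_i(\tau)\\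 \boldsymbol{f}_i(\tau)\end{bmatrix}\in\mathbb{R}^{\varkappa_i},\qquad \boldsymbol{g}_i(\tau)=\begin{bmatrix}\boldsymbol{\phi}_i(\tau)\\ \boldsymbol{h}_i(\tau)\end{bmatrix}\in\mathbb{R}^{\kappa_i},$$ one has, for almost every $\tau\in\mathcal{I}_i$, $$\widetilde{A}_i(\tau)=\widehat{A}_i\,(\boldsymbol{g}_i(\tau)\otimes I_n),\qquad \widetilde{C}_i(\tau)=\widehat{C}_i\,(\boldsymbol{g}_i(\tau)\otimes I_n),\qquad \frac{\mathrm{d}\boldsymbol{f}_i(\tau)}{\mathrm{d}\tau}=M_i\boldsymbol{h}_i(\tau),$$ and $$\mathsf{G}_i:=\int_{\mathcal{I}_i}\boldsymbol{g}_i(\tau)\boldsymbol{g}_i^\top(\tau)\,\mathrm{d}\tau\succ 0 .$$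
   Context: $\otimes$ is the Kronecker product and $\succ0$ means symmetric positive definite. $L^2(\mathcal{I};\cdot)$ denotes square-integrable Lebesgue measurable functions on the interval $\mathcal{I}$, and $H^1(\mathcal{I};\mathbb{R}^{d})$ is the Sobolev space of functions whose weak derivative lies in $L^2(\mathcal{I};\mathbb{R}^d)$; $\frac{\mathrm d}{\mathrm d\tau}$ denotes the weak derivative. If $\delta_i=0$ (resp. $\mu_i=0$), then $\boldsymbol{\varphi}_i$ (resp. $\boldsymbol{\phi}_i$) is an empty ($0\times1$) vector and the corresponding block is absent. *)

theory Defs
  imports "HOL-Analysis.Analysis" "Jordan_Normal_Form.Matrix"
begin

unbundle no vec_syntax
unbundle no inner_syntax

text \<open>
  Some dimensions are existentially quantified, so vectors and matrices are those of
  \<^theory>\<open>Jordan_Normal_Form.Matrix\<close>, with explicit carriers and indices starting at 0.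
  A function on \<open>S\<close> is a total function whose values outside \<open>S\<close> are irrelevant.
\<close>

section \<open>Matrices\<close>

definition kronecker :: "real mat \<Rightarrow> real mat \<Rightarrow> real mat" (infixl \<open>\<otimes>\<^sub>K\<close> 70) where
  "A \<otimes>\<^sub>K B = mat (dim_row A * dim_row B) (dim_col A * dim_col B)
     (\<lambda>(i, j). A $$ (i div dim_row B, j div dim_col B) * B $$ (i mod dim_row B, j mod dim_col B))"

definition col_mat :: "real Matrix.vec \<Rightarrow> real mat" where
  "col_mat v = mat_of_cols (dim_vec v) [v]"

definition sym_pos_def :: "nat \<Rightarrow> real mat \<Rightarrow> bool" where
  "sym_pos_def k G \<longleftrightarrow> G \<in> carrier_mat k k \<and> transpose_mat G = G \<and>
     (\<forall>x \<in> carrier_vec k. x \<noteq> 0\<^sub>v k \<longrightarrow> x \<bullet> (G *\<^sub>v x) > 0)"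

text \<open>Entrywise Lebesgue integral of a function with \<open>nr \<times> nc\<close> matrix values.\<close>
definition mat_integral :: "real set \<Rightarrow> nat \<Rightarrow> nat \<Rightarrow> (real \<Rightarrow> real mat) \<Rightarrow> real mat" where
  "mat_integral S nr nc F = mat nr nc (\<lambda>(i, j). \<integral>\<tau>. F \<tau> $$ (i, j) \<partial>lebesgue_on S)"

section \<open>Square-integrable functions\<close>

definition L2_vec :: "real set \<Rightarrow> nat \<Rightarrow> (real \<Rightarrow> real Matrix.vec) set" where
  "L2_vec S d = {f. (\<forall>\<tau>\<in>S. f \<tau> \<in> carrier_vec d) \<and>
     (\<forall>i<d. (\<lambda>\<tau>. f \<tau> $ i) \<in> borel_measurable (lebesgue_on S)) \<and>
     integrable (lebesgue_on S) (\<lambda>\<tau>. \<Sum>i<d. (f \<tau> $ i)\<^sup>2)}"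

text \<open>The norm on matrices is the Frobenius norm.\<close>
definition L2_mat :: "real set \<Rightarrow> nat \<Rightarrow> nat \<Rightarrow> (real \<Rightarrow> real mat) set" where
  "L2_mat S nr nc = {F. (\<forall>\<tau>\<in>S. F \<tau> \<in> carrier_mat nr nc) \<and>
     (\<forall>i<nr. \<forall>j<nc. (\<lambda>\<tau>. F \<tau> $$ (i, j)) \<in> borel_measurable (lebesgue_on S)) \<and>
     integrable (lebesgue_on S) (\<lambda>\<tau>. \<Sum>i<nr. \<Sum>j<nc. (F \<tau> $$ (i, j))\<^sup>2)}"

section \<open>Weak derivatives and the Sobolev space of order one\<close>

definition test_function :: "real set \<Rightarrow> (real \<Rightarrow> real) \<Rightarrow> bool" where
  "test_function S \<psi> \<longleftrightarrow> (\<forall>k. (deriv ^^ k) \<psi> differentiable_on UNIV) \<and>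
     compact (closure {x. \<psi> x \<noteq> 0}) \<and> closure {x. \<psi> x \<noteq> 0} \<subseteq> interior S"

definition locally_integrable :: "real set \<Rightarrow> (real \<Rightarrow> real) \<Rightarrow> bool" where
  "locally_integrable S u \<longleftrightarrow> (\<forall>K. compact K \<and> K \<subseteq> interior S \<longrightarrow> integrable (lebesgue_on K) u)"

text \<open>
  Local integrability is required explicitly: the integral of a non-integrable function is 0
  in the library, so the integration-by-parts identity alone could hold for spurious reasons.
\<close>
definition has_weak_derivative :: "real set \<Rightarrow> (real \<Rightarrow> real) \<Rightarrow> (real \<Rightarrow> real) \<Rightarrow> bool" where
  "has_weak_derivative S u u' \<longleftrightarrow> locally_integrable S u \<and> locally_integrable S u' \<and>
     (\<forall>\<psi>. test_function S \<psi> \<longrightarrow>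
       (\<integral>\<tau>. u \<tau> * deriv \<psi> \<tau> \<partial>lebesgue_on S) = - (\<integral>\<tau>. u' \<tau> * \<psi> \<tau> \<partial>lebesgue_on S))"

definition has_weak_derivative_vec ::
  "real set \<Rightarrow> nat \<Rightarrow> (real \<Rightarrow> real Matrix.vec) \<Rightarrow> (real \<Rightarrow> real Matrix.vec) \<Rightarrow> bool" where
  "has_weak_derivative_vec S d f f' \<longleftrightarrow>
     (\<forall>\<tau>\<in>S. f \<tau> \<in> carrier_vec d \<and> f' \<tau> \<in> carrier_vec d) \<and>
     (\<forall>i<d. has_weak_derivative S (\<lambda>\<tau>. f \<tau> $ i) (\<lambda>\<tau>. f' \<tau> $ i))"

definition H1_vec :: "real set \<Rightarrow> nat \<Rightarrow> (real \<Rightarrow> real Matrix.vec) set" where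
  "H1_vec S d = {f \<in> L2_vec S d. \<exists>f' \<in> L2_vec S d. has_weak_derivative_vec S d f f'}"

end

theory Submission
  imports Defs
begin

text \<open>
  Sufficiency: each entry of \<open>A\<^sub>i\<close> and \<open>C\<^sub>i\<close> agrees almost everywhere with a linear combination of
  square-integrable functions. Necessity: take \<open>d = 1\<close>, \<open>f = 1\<close>, \<open>\<delta> = 0\<close> and \<open>M = 0\<close>, and enlarge
  the family \<open>(1)\<close> by those entries of \<open>A\<^sub>i\<close> and \<open>C\<^sub>i\<close> that are not yet almost everywhere in its
  span. The resulting family is linearly independent modulo null sets, which is exactly positive
  definiteness of its Gram matrix.
\<close>

section \<open>Square-integrable real functions\<close>

definition square_integrable :: "'a measure \<Rightarrow> ('a \<Rightarrow> real) \<Rightarrow> bool" where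
  "square_integrable M u \<longleftrightarrow> u \<in> borel_measurable M \<and> integrable M (\<lambda>x. (u x)\<^sup>2)"

lemma square_integrable_cong:
  assumes "\<And>x. x \<in> space M \<Longrightarrow> u x = v x"
  shows "square_integrable M u \<longleftrightarrow> square_integrable M v"
  unfolding square_integrable_def
  using assms measurable_cong[of M u v] Bochner_Integration.integrable_cong[of M M "\<lambda>x. (u x)\<^sup>2" "\<lambda>x. (v x)\<^sup>2"]
  by simp

text \<open>The product is dominated pointwise by the sum of the squares. This bounds the cross term
  in \<open>square_integrable_add\<close> and makes the Gram entries integrable.\<close>

lemma square_integrable_mult:
  assumes "square_integrable M u" "square_integrable M v"
  shows "integrable M (\<lambda>x. u x * v x)"
proof (rule Bochner_Integration.integrable_bound)
  show "integrable M (\<lambda>x. (u x)\<^sup>2 + (v x)\<^sup>2)"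
    using assms by (simp add: square_integrable_def)
  show "(\<lambda>x. u x * v x) \<in> borel_measurable M"
    using assms by (auto simp: square_integrable_def)
  have "\<bar>a * b\<bar> \<le> a\<^sup>2 + b\<^sup>2" for a b :: real
  proof -
    have "2 * (\<bar>a\<bar> * \<bar>b\<bar>) \<le> a\<^sup>2 + b\<^sup>2"
      using sum_squares_bound[of "\<bar>a\<bar>" "\<bar>b\<bar>"] by (simp add: mult.assoc)
    moreover have "0 \<le> \<bar>a\<bar> * \<bar>b\<bar>" by simp
    ultimately show ?thesis unfolding abs_mult by linarith
  qed
  then show "AE x in M. norm (u x * v x) \<le> norm ((u x)\<^sup>2 + (v x)\<^sup>2)"
    by simp
qed

lemma square_integrable_add:
  assumes "square_integrable M u" "square_integrable M v"
  shows "square_integrable M (\<lambda>x. u x + v x)"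
  using assms square_integrable_mult[OF assms]
  by (auto simp: square_integrable_def power2_sum mult.assoc)

lemma square_integrable_cmult:
  "square_integrable M u \<Longrightarrow> square_integrable M (\<lambda>x. c * u x)"
  by (auto simp: square_integrable_def power_mult_distrib)

lemma square_integrable_sum:
  assumes "finite K" "\<And>k. k \<in> K \<Longrightarrow> square_integrable M (u k)"
  shows "square_integrable M (\<lambda>x. \<Sum>k\<in>K. u k x)"
  using assms
proof (induction K rule: finite_induct)
  case empty
  then show ?case by (simp add: square_integrable_def)
next
  case (insert k K)
  then show ?case by (simp add: square_integrable_add)
qed

section \<open>Stability under changes on null sets\<close>

text \<open>\<open>lebesgue\<close> is a completion, and null sets of the restriction to a
  measurable \<open>S\<close> are Lebesgue null sets inside \<open>S\<close>.\<close>

lemma complete_measure_lebesgue_on: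
  assumes "S \<in> sets lebesgue"
  shows "complete_measure (lebesgue_on S)"
proof
  fix A B assume "B \<subseteq> A" "A \<in> null_sets (lebesgue_on S)"
  then have "B \<subseteq> S" "B \<in> sets lebesgue"
    using assms completion.complete[of B A] by (auto simp: null_sets_restrict_space)
  then show "B \<in> sets (lebesgue_on S)"
    by (auto simp: sets_restrict_space_iff assms)
qed

text \<open>Preimages of a Borel set under \<open>f\<close> and \<open>g\<close> agree up to a null
  set, and completeness turns such agreement into measurability.\<close>

lemma (in complete_measure) borel_measurable_AE_cong:
  assumes g: "g \<in> borel_measurable M" and eq: "AE x in M. f x = g x"
  shows "f \<in> borel_measurable M"
proof (rule measurableI)
  fix B :: "'b set" assume "B \<in> sets borel"
  then have "g -` B \<inter> space M \<in> sets M"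
    using g by (rule measurable_sets[rotated])
  moreover have "AE x in M. x \<in> g -` B \<inter> space M \<longleftrightarrow> x \<in> f -` B \<inter> space M"
    using eq by eventually_elim auto
  ultimately show "f -` B \<inter> space M \<in> sets M"
    using in_sets_AE by blast
qed simp

text \<open>Even the measurability of \<open>u\<close> is obtained here. This matters for
  sufficiency, where the entries of the given matrices are known only through an almost everywhere
  identity.\<close>

lemma square_integrable_AE_cong:
  assumes "S \<in> sets lebesgue" "square_integrable (lebesgue_on S) v"
    and eq: "AE x in lebesgue_on S. u x = v x"
  shows "square_integrable (lebesgue_on S) u"
proof -
  have u: "u \<in> borel_measurable (lebesgue_on S)"
    using complete_measure.borel_measurable_AE_cong[OF complete_measure_lebesgue_on[OF assms(1)] _ eq]
      assms(2) by (simp add: square_integrable_def)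
  have "AE x in lebesgue_on S. (v x)\<^sup>2 = (u x)\<^sup>2"
    using eq by eventually_elim simp
  then have "integrable (lebesgue_on S) (\<lambda>x. (u x)\<^sup>2)"
    using assms(2) u by (auto simp: square_integrable_def intro: integrable_cong_AE_imp)
  with u show ?thesis by (simp add: square_integrable_def)
qed

lemma square_integrable_of_le_integrable:
  assumes "u \<in> borel_measurable M" "integrable M w" "\<And>x. (u x)\<^sup>2 \<le> w x"
  shows "square_integrable M u"
proof -
  have "norm ((u x)\<^sup>2) \<le> norm (w x)" for x
    using assms(3)[of x] by simp
  then have "integrable M (\<lambda>x. (u x)\<^sup>2)"
    using assms(1) by (intro Bochner_Integration.integrable_bound[OF assms(2)]) auto
  with assms(1) show ?thesis by (simp add: square_integrable_def)
qed

section \<open>Entrywise description of \<open>L2_vec\<close> and \<open>L2_mat\<close>\<close>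

text \<open>Each squared component is bounded by the sum of all of them; conversely, a finite sum of
  integrable functions is integrable.\<close>

lemma L2_vec_iff:
  "f \<in> L2_vec S d \<longleftrightarrow> (\<forall>\<tau>\<in>S. f \<tau> \<in> carrier_vec d) \<and>
     (\<forall>i<d. square_integrable (lebesgue_on S) (\<lambda>\<tau>. f \<tau> $ i))"
proof -
  have "(f \<tau> $ i)\<^sup>2 \<le> (\<Sum>i<d. (f \<tau> $ i)\<^sup>2)" if "i < d" for i \<tau>
    using member_le_sum[of i "{..<d}" "\<lambda>i. (f \<tau> $ i)\<^sup>2"] that by auto
  then show ?thesis
    unfolding L2_vec_def
    by (auto intro: square_integrable_of_le_integrable) (auto simp: square_integrable_def)
qed

lemma L2_mat_iff:
  "F \<in> L2_mat S nr nc \<longleftrightarrow> (\<forall>\<tau>\<in>S. F \<tau> \<in> carrier_mat nr nc) \<and>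
     (\<forall>i<nr. \<forall>j<nc. square_integrable (lebesgue_on S) (\<lambda>\<tau>. F \<tau> $$ (i, j)))"
proof -
  have le: "(F \<tau> $$ (i, j))\<^sup>2 \<le> (\<Sum>i<nr. \<Sum>j<nc. (F \<tau> $$ (i, j))\<^sup>2)" if "i < nr" "j < nc" for i j \<tau>
  proof -
    have "(F \<tau> $$ (i, j))\<^sup>2 \<le> (\<Sum>j<nc. (F \<tau> $$ (i, j))\<^sup>2)"
      using member_le_sum[of j "{..<nc}" "\<lambda>j. (F \<tau> $$ (i, j))\<^sup>2"] that by auto
    also have "\<dots> \<le> (\<Sum>i<nr. \<Sum>j<nc. (F \<tau> $$ (i, j))\<^sup>2)"
      using member_le_sum[of i "{..<nr}" "\<lambda>i. \<Sum>j<nc. (F \<tau> $$ (i, j))\<^sup>2"] that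
      by (auto simp: sum_nonneg)
    finally show ?thesis .
  qed
  show ?thesis
  proof
    assume F: "F \<in> L2_mat S nr nc"
    have "square_integrable (lebesgue_on S) (\<lambda>\<tau>. F \<tau> $$ (i, j))" if "i < nr" "j < nc" for i j
      by (rule square_integrable_of_le_integrable[OF _ _ le[OF that]])
        (use F that in \<open>simp_all add: L2_mat_def\<close>)
    with F show "(\<forall>\<tau>\<in>S. F \<tau> \<in> carrier_mat nr nc) \<and>
        (\<forall>i<nr. \<forall>j<nc. square_integrable (lebesgue_on S) (\<lambda>\<tau>. F \<tau> $$ (i, j)))"
      by (simp add: L2_mat_def)
  next
    assume F: "(\<forall>\<tau>\<in>S. F \<tau> \<in> carrier_mat nr nc) \<and>
      (\<forall>i<nr. \<forall>j<nc. square_integrable (lebesgue_on S) (\<lambda>\<tau>. F \<tau> $$ (i, j)))"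
    then have "integrable (lebesgue_on S) (\<lambda>\<tau>. \<Sum>i<nr. \<Sum>j<nc. (F \<tau> $$ (i, j))\<^sup>2)"
      by (intro Bochner_Integration.integrable_sum) (simp add: square_integrable_def)
    with F show "F \<in> L2_mat S nr nc"
      by (simp add: L2_mat_def square_integrable_def)
  qed
qed

lemma L2_vec_append:
  assumes "f \<in> L2_vec S d" "g \<in> L2_vec S e"
  shows "(\<lambda>\<tau>. f \<tau> @\<^sub>v g \<tau>) \<in> L2_vec S (d + e)"
proof -
  have carrier: "f \<tau> \<in> carrier_vec d" "g \<tau> \<in> carrier_vec e" if "\<tau> \<in> S" for \<tau>
    using assms that by (auto simp: L2_vec_iff)
  have "square_integrable (lebesgue_on S) (\<lambda>\<tau>. (f \<tau> @\<^sub>v g \<tau>) $ i)" if i: "i < d + e" for i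
  proof (cases "i < d")
    case True
    with assms have "square_integrable (lebesgue_on S) (\<lambda>\<tau>. f \<tau> $ i)"
      by (simp add: L2_vec_iff)
    \<comment> \<open>The dimension of \<open>f \<tau>\<close>, and hence the position where the
      second block starts, is known only for \<open>\<tau>\<close> in \<open>S\<close>, so the
      components are compared on the space of the measure.\<close>
    then show ?thesis
    proof (rule iffD1[OF square_integrable_cong, rotated])
      fix \<tau> assume "\<tau> \<in> space (lebesgue_on S)"
      with carrier[of \<tau>] i True show "f \<tau> $ i = (f \<tau> @\<^sub>v g \<tau>) $ i"
        by auto
    qed
  next
    case False
    with assms i have "square_integrable (lebesgue_on S) (\<lambda>\<tau>. g \<tau> $ (i - d))"
      by (simp add: L2_vec_iff)
    then show ?thesis
    proof (rule iffD1[OF square_integrable_cong, rotated])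
      fix \<tau> assume "\<tau> \<in> space (lebesgue_on S)"
      with carrier[of \<tau>] i False show "g \<tau> $ (i - d) = (f \<tau> @\<^sub>v g \<tau>) $ i"
        by auto
    qed
  qed
  with carrier show ?thesis by (auto simp: L2_vec_iff)
qed

section \<open>Coefficient matrices and Kronecker products\<close>

lemma mult_kronecker_one_carrier:
  assumes "F \<in> carrier_mat nr (K * n)" "v \<in> carrier_vec K"
  shows "F * (col_mat v \<otimes>\<^sub>K 1\<^sub>m n) \<in> carrier_mat nr n"
  using assms by (auto simp: kronecker_def col_mat_def)

text \<open>Row \<open>k * n + p\<close> of the Kronecker product carries \<open>v $ k\<close> times
  entry \<open>(p, j)\<close> of the identity, so only \<open>p = j\<close> survives in each block.
  Thus every entry of the product is a linear combination of the components of
  \<open>v\<close>.\<close>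

lemma mult_kronecker_one_index:
  assumes F: "F \<in> carrier_mat nr (K * n)" and v: "v \<in> carrier_vec K" and i: "i < nr" and j: "j < n"
  shows "(F * (col_mat v \<otimes>\<^sub>K 1\<^sub>m n)) $$ (i, j) = (\<Sum>k<K. F $$ (i, k * n + j) * v $ k)"
proof -
  let ?t = "\<lambda>q. F $$ (i, q) * (v $ (q div n) * (if q mod n = j then 1 else 0))"
  have "(F * (col_mat v \<otimes>\<^sub>K 1\<^sub>m n)) $$ (i, j) =
      (\<Sum>q = 0..<K * n. F $$ (i, q) * (col_mat v \<otimes>\<^sub>K 1\<^sub>m n) $$ (q, j))"
    using F v i j by (auto simp: kronecker_def col_mat_def scalar_prod_def)
  also have "\<dots> = (\<Sum>q = 0..<K * n. ?t q)"
  proof (rule sum.cong)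
    fix q assume q: "q \<in> {0..<K * n}"
    then have "q div n < K" "q mod n < n"
      using j by (auto simp: less_mult_imp_div_less)
    then show "F $$ (i, q) * (col_mat v \<otimes>\<^sub>K 1\<^sub>m n) $$ (q, j) = ?t q"
      using q v j by (auto simp: kronecker_def col_mat_def mat_of_cols_index)
  qed simp
  \<comment> \<open>The index range is cut into \<open>K\<close> consecutive blocks of length
    \<open>n\<close>; block \<open>k\<close> is where \<open>q div n = k\<close>.\<close>
  also have "\<dots> = (\<Sum>k<K. sum ?t {k * n..<k * n + n})"
    by (simp add: sum.nat_group atLeast0LessThan)
  also have "\<dots> = (\<Sum>k<K. F $$ (i, k * n + j) * v $ k)"
  proof (rule sum.cong)
    fix k
    have "sum ?t {k * n..<k * n + n} = (\<Sum>p<n. ?t (p + k * n))"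
      using sum.shift_bounds_nat_ivl[of ?t 0 "k * n" n] by (simp add: atLeast0LessThan add.commute)
    also have "\<dots> = (\<Sum>p<n. if p = j then F $$ (i, k * n + j) * v $ k else 0)"
      by (rule sum.cong) (auto simp: add.commute)
    also have "\<dots> = F $$ (i, k * n + j) * v $ k"
      using j by simp
    finally show "sum ?t {k * n..<k * n + n} = F $$ (i, k * n + j) * v $ k" .
  qed simp
  finally show ?thesis .
qed

text \<open>By \<open>mult_kronecker_one_index\<close> each entry of \<open>F\<close> is almost
  everywhere a finite linear combination of the components of \<open>g\<close>.\<close>

lemma L2_mat_of_AE_representation:
  assumes S: "S \<in> sets lebesgue" and F: "\<And>\<tau>. \<tau> \<in> S \<Longrightarrow> F \<tau> \<in> carrier_mat nr n"
    and g: "g \<in> L2_vec S K" and F': "F' \<in> carrier_mat nr (K * n)"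
    and eq: "AE \<tau> in lebesgue_on S. F \<tau> = F' * (col_mat (g \<tau>) \<otimes>\<^sub>K 1\<^sub>m n)"
  shows "F \<in> L2_mat S nr n"
proof -
  have "square_integrable (lebesgue_on S) (\<lambda>\<tau>. F \<tau> $$ (i, j))" if ij: "i < nr" "j < n" for i j
  proof (rule square_integrable_AE_cong[OF S])
    show "square_integrable (lebesgue_on S) (\<lambda>\<tau>. \<Sum>k<K. F' $$ (i, k * n + j) * g \<tau> $ k)"
      using g by (intro square_integrable_sum square_integrable_cmult) (auto simp: L2_vec_iff)
    show "AE \<tau> in lebesgue_on S. F \<tau> $$ (i, j) = (\<Sum>k<K. F' $$ (i, k * n + j) * g \<tau> $ k)"
      using eq AE_space
    proof eventually_elim
      case (elim \<tau>)
      then have "g \<tau> \<in> carrier_vec K"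
        using g by (auto simp: L2_vec_iff)
      with elim show ?case
        by (simp add: mult_kronecker_one_index[OF F' _ ij])
    qed
  qed
  with F show ?thesis by (auto simp: L2_mat_iff)
qed

section \<open>Linear independence modulo null sets\<close>

text \<open>A list fixes an order of the spanning functions, which later becomes the order of the
  components of \<open>g\<close>.\<close>

definition ae_span :: "'a measure \<Rightarrow> ('a \<Rightarrow> real) list \<Rightarrow> ('a \<Rightarrow> real) set" where
  "ae_span M vs = {u. \<exists>c. AE x in M. u x = (\<Sum>k<length vs. c k * (vs ! k) x)}"

definition ae_independent :: "'a measure \<Rightarrow> ('a \<Rightarrow> real) list \<Rightarrow> bool" where
  "ae_independent M vs \<longleftrightarrow>
     (\<forall>c. (AE x in M. (\<Sum>k<length vs. c k * (vs ! k) x) = 0) \<longrightarrow> (\<forall>k<length vs. c k = 0))"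

lemma ae_span_Cons:
  assumes "u \<in> ae_span M vs"
  shows "u \<in> ae_span M (v # vs)"
proof -
  obtain c where "AE x in M. u x = (\<Sum>k<length vs. c k * (vs ! k) x)"
    using assms by (auto simp: ae_span_def)
  \<comment> \<open>\<open>case_nat 0 c\<close> gives the new head coefficient 0 and shifts the old
    coefficients by one.\<close>
  then have "AE x in M. u x = (\<Sum>k<length (v # vs). case_nat 0 c k * ((v # vs) ! k) x)"
    by eventually_elim (simp add: sum.lessThan_Suc_shift del: sum.lessThan_Suc)
  then show ?thesis by (auto simp: ae_span_def)
qed

lemma ae_span_head: "v \<in> ae_span M (v # vs)"
proof -
  have "v x = (\<Sum>k<length (v # vs). case_nat 1 (\<lambda>_. 0) k * ((v # vs) ! k) x)" for x
    by (simp add: sum.lessThan_Suc_shift del: sum.lessThan_Suc)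
  then show ?thesis unfolding ae_span_def by auto
qed

text \<open>In a vanishing combination a nonzero head coefficient could be divided out, placing
  \<open>v\<close> in the span of \<open>vs\<close>. So it is 0, and independence of
  \<open>vs\<close> handles the others.\<close>

lemma ae_independent_Cons:
  assumes vs: "ae_independent M vs" and v: "v \<notin> ae_span M vs"
  shows "ae_independent M (v # vs)"
  unfolding ae_independent_def
proof (intro allI impI)
  fix c k
  assume "AE x in M. (\<Sum>k<length (v # vs). c k * ((v # vs) ! k) x) = 0" and k: "k < length (v # vs)"
  then have ae: "AE x in M. c 0 * v x + (\<Sum>k<length vs. c (Suc k) * (vs ! k) x) = 0"
    by (simp add: sum.lessThan_Suc_shift del: sum.lessThan_Suc)
  have c0: "c 0 = 0"
  proof (rule ccontr)
    assume "c 0 \<noteq> 0"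
    have "AE x in M. v x = (\<Sum>k<length vs. (- c (Suc k) / c 0) * (vs ! k) x)"
      using ae
    proof eventually_elim
      case (elim x)
      have "(\<Sum>k<length vs. (- c (Suc k) / c 0) * (vs ! k) x) =
          - (\<Sum>k<length vs. c (Suc k) * (vs ! k) x) / c 0"
        by (simp add: sum_negf sum_divide_distrib)
      also have "\<dots> = c 0 * v x / c 0"
        using elim by (intro arg_cong[where f = "\<lambda>y. y / c 0"]) linarith
      finally show ?case using \<open>c 0 \<noteq> 0\<close> by simp
    qed
    then have "v \<in> ae_span M vs"
      unfolding ae_span_def by (intro CollectI exI[of _ "\<lambda>k. - c (Suc k) / c 0"])
    with v show False by contradiction
  qed
  with ae have "AE x in M. (\<Sum>k<length vs. c (Suc k) * (vs ! k) x) = 0"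
    by simp
  with vs have "\<forall>k<length vs. c (Suc k) = 0"
    unfolding ae_independent_def by (elim allE[of _ "\<lambda>k. c (Suc k)"] impE)
  with c0 k show "c k = 0" by (cases k) auto
qed

text \<open>Greedy selection: a function from \<open>us\<close> is prepended exactly when it is not
  yet in the span. The starting family \<open>ws\<close> thus remains a suffix, as the block order
  of \<open>g\<close> demands.\<close>

lemma ae_independent_extension:
  assumes "ae_independent M ws"
  shows "\<exists>vs. set vs \<subseteq> set us \<and> ae_independent M (vs @ ws) \<and> set us \<subseteq> ae_span M (vs @ ws)"
proof (induction us)
  case Nil
  show ?case using assms by (intro exI[of _ "[]"]) simp
next
  case (Cons u us)
  then obtain vs where vs: "set vs \<subseteq> set us" "ae_independent M (vs @ ws)"
    "set us \<subseteq> ae_span M (vs @ ws)" by blast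
  show ?case
  proof (cases "u \<in> ae_span M (vs @ ws)")
    case True
    with vs show ?thesis by (intro exI[of _ vs]) auto
  next
    case False
    then have "ae_independent M (u # vs @ ws)"
      using vs(2) ae_independent_Cons by blast
    moreover have "set (u # us) \<subseteq> ae_span M (u # vs @ ws)"
      using vs(3) ae_span_head ae_span_Cons by fastforce
    ultimately show ?thesis
      using vs(1) by (intro exI[of _ "u # vs"]) auto
  qed
qed

text \<open>A nonzero constant can vanish almost everywhere only if the whole space is null.\<close>

lemma ae_independent_one:
  assumes "emeasure M (space M) \<noteq> 0"
  shows "ae_independent M [\<lambda>_. 1]"
  unfolding ae_independent_def
proof (intro allI impI)
  fix c :: "nat \<Rightarrow> real" and k
  assume ae: "AE x in M. (\<Sum>k<length [\<lambda>_. 1 :: real]. c k * ([\<lambda>_. 1] ! k) x) = 0" and "k < length [\<lambda>_. 1 :: real]"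
  have "\<not> (AE x in M. False)"
    using assms by (auto simp: AE_iff_null)
  with ae have "c 0 = 0" by (cases "c 0 = 0") simp_all
  with \<open>k < length [\<lambda>_. 1 :: real]\<close> show "c k = 0" by simp
qed

section \<open>Gram matrices and coefficient matrices\<close>

text \<open>The quadratic form at \<open>x\<close> is the integral of the square of the combination
  of the \<open>g \<tau> $ i\<close> with coefficients \<open>x $ i\<close>. If it were 0, that
  combination would vanish almost everywhere, and independence would force \<open>x\<close> to be
  0.\<close>

lemma gram_sym_pos_def:
  fixes g :: "real \<Rightarrow> real Matrix.vec"
  assumes g: "g \<in> L2_vec S K" and vs: "length vs = K" "\<And>\<tau> k. k < K \<Longrightarrow> g \<tau> $ k = (vs ! k) \<tau>"
    and dim: "\<And>\<tau>. g \<tau> \<in> carrier_vec K"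
    and ind: "ae_independent (lebesgue_on S) vs"
  shows "sym_pos_def K (mat_integral S K K (\<lambda>\<tau>. col_mat (g \<tau>) * transpose_mat (col_mat (g \<tau>))))"
    (is "sym_pos_def K ?G")
proof -
  let ?L = "lebesgue_on S"
  have sq: "square_integrable ?L (\<lambda>\<tau>. g \<tau> $ i)" if "i < K" for i
    using g that by (simp add: L2_vec_iff)
  have int: "integrable ?L (\<lambda>\<tau>. g \<tau> $ i * g \<tau> $ j)" if "i < K" "j < K" for i j
    using sq that by (intro square_integrable_mult)
  have G: "?G $$ (i, j) = (\<integral>\<tau>. g \<tau> $ i * g \<tau> $ j \<partial>?L)" if "i < K" "j < K" for i j
  proof -
    have "(col_mat (g \<tau>) * transpose_mat (col_mat (g \<tau>))) $$ (i, j) = g \<tau> $ i * g \<tau> $ j" for \<tau>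
      using that dim[of \<tau>] by (auto simp: col_mat_def mat_of_cols_index scalar_prod_def)
    then show ?thesis using that by (simp add: mat_integral_def)
  qed
  have carrier: "?G \<in> carrier_mat K K" by (simp add: mat_integral_def)
  have "transpose_mat ?G = ?G"
    using carrier by (intro eq_matI) (auto simp: G mult.commute)
  moreover have "x \<bullet> (?G *\<^sub>v x) > 0" if x: "x \<in> carrier_vec K" "x \<noteq> 0\<^sub>v K" for x
  proof -
    let ?s = "\<lambda>\<tau>. \<Sum>i<K. x $ i * g \<tau> $ i"
    have s: "square_integrable ?L ?s"
      using sq by (intro square_integrable_sum square_integrable_cmult) auto
    have "x \<bullet> (?G *\<^sub>v x) = (\<Sum>i<K. \<Sum>j<K. x $ i * (x $ j * (\<integral>\<tau>. g \<tau> $ i * g \<tau> $ j \<partial>?L)))"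
      using x carrier
      by (auto simp: scalar_prod_def G atLeast0LessThan sum_distrib_left mult_ac intro!: sum.cong)
    \<comment> \<open>The two finite sums move under the integral one at a time, inner sum first;
      \<open>int\<close> supplies integrability.\<close>
    also have "\<dots> = (\<Sum>i<K. \<integral>\<tau>. (\<Sum>j<K. x $ i * (x $ j * (g \<tau> $ i * g \<tau> $ j))) \<partial>?L)"
    proof (rule sum.cong)
      fix i assume "i \<in> {..<K}"
      then show "(\<Sum>j<K. x $ i * (x $ j * (\<integral>\<tau>. g \<tau> $ i * g \<tau> $ j \<partial>?L))) =
          (\<integral>\<tau>. (\<Sum>j<K. x $ i * (x $ j * (g \<tau> $ i * g \<tau> $ j))) \<partial>?L)"
        by (subst Bochner_Integration.integral_sum) (simp_all add: int)
    qed simp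
    also have "\<dots> = (\<integral>\<tau>. (\<Sum>i<K. \<Sum>j<K. x $ i * (x $ j * (g \<tau> $ i * g \<tau> $ j))) \<partial>?L)"
      by (rule Bochner_Integration.integral_sum[symmetric], rule Bochner_Integration.integrable_sum)
        (simp add: int)
    also have "\<dots> = (\<integral>\<tau>. (?s \<tau>)\<^sup>2 \<partial>?L)"
      by (simp add: power2_eq_square sum_product mult_ac)
    finally have eq: "x \<bullet> (?G *\<^sub>v x) = (\<integral>\<tau>. (?s \<tau>)\<^sup>2 \<partial>?L)" .
    have "(\<integral>\<tau>. (?s \<tau>)\<^sup>2 \<partial>?L) \<noteq> 0"
    proof
      assume "(\<integral>\<tau>. (?s \<tau>)\<^sup>2 \<partial>?L) = 0"
      then have "AE \<tau> in ?L. (?s \<tau>)\<^sup>2 = 0"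
        using s by (subst (asm) integral_nonneg_eq_0_iff_AE) (auto simp: square_integrable_def)
      then have "AE \<tau> in ?L. (\<Sum>i<length vs. x $ i * (vs ! i) \<tau>) = 0"
        by eventually_elim (simp add: vs)
      with ind have "\<forall>i<length vs. x $ i = 0"
        unfolding ae_independent_def by (elim allE[of _ "\<lambda>i. x $ i"] impE)
      with x vs show False by auto
    qed
    moreover have "(\<integral>\<tau>. (?s \<tau>)\<^sup>2 \<partial>?L) \<ge> 0" by simp
    ultimately show ?thesis using eq by linarith
  qed
  ultimately show ?thesis using carrier by (simp add: sym_pos_def_def)
qed

text \<open>Converse use of \<open>mult_kronecker_one_index\<close>: the coefficients of the
  individual entries are assembled into one constant matrix.\<close>

lemma mat_AE_representation:
  fixes F :: "real \<Rightarrow> real mat"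
  assumes F: "\<And>\<tau>. \<tau> \<in> S \<Longrightarrow> F \<tau> \<in> carrier_mat nr n"
    and vs: "length vs = K" "\<And>\<tau> k. k < K \<Longrightarrow> g \<tau> $ k = (vs ! k) \<tau>"
    and dim: "\<And>\<tau>. g \<tau> \<in> carrier_vec K"
    and span: "\<And>i j. i < nr \<Longrightarrow> j < n \<Longrightarrow> (\<lambda>\<tau>. F \<tau> $$ (i, j)) \<in> ae_span (lebesgue_on S) vs"
  shows "\<exists>F' \<in> carrier_mat nr (K * n).
    AE \<tau> in lebesgue_on S. F \<tau> = F' * (col_mat (g \<tau>) \<otimes>\<^sub>K 1\<^sub>m n)"
proof -
  define c where "c i j = (SOME c. AE \<tau> in lebesgue_on S.
      F \<tau> $$ (i, j) = (\<Sum>k<length vs. c k * (vs ! k) \<tau>))" for i j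
  have c: "AE \<tau> in lebesgue_on S. F \<tau> $$ (i, j) = (\<Sum>k<length vs. c i j k * (vs ! k) \<tau>)"
    if "i < nr" "j < n" for i j
    using someI_ex[OF span[OF that, unfolded ae_span_def mem_Collect_eq]] unfolding c_def .
  \<comment> \<open>Column \<open>k * n + j\<close> of row \<open>i\<close> must hold the
    coefficient of component \<open>k\<close> in entry \<open>(i, j)\<close>; \<open>q div n\<close>
    and \<open>q mod n\<close> recover \<open>k\<close> and \<open>j\<close>.\<close>
  define F' where "F' = mat nr (K * n) (\<lambda>(i, q). c i (q mod n) (q div n))"
  have F': "F' \<in> carrier_mat nr (K * n)" by (simp add: F'_def)
  have index: "F' $$ (i, k * n + j) = c i j k" if "i < nr" "j < n" "k < K" for i j k
  proof -
    have "k * n + j < Suc k * n" using that by simp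
    also have "\<dots> \<le> K * n" using that by (intro mult_right_mono) auto
    finally show ?thesis using that by (simp add: F'_def)
  qed
  \<comment> \<open>There are only finitely many entries, so their exceptional null sets combine
    into one.\<close>
  have "AE \<tau> in lebesgue_on S. \<forall>i\<in>{..<nr}. \<forall>j\<in>{..<n}.
      F \<tau> $$ (i, j) = (\<Sum>k<length vs. c i j k * (vs ! k) \<tau>)"
    by (intro AE_finite_allI) (auto intro: c)
  with AE_space have "AE \<tau> in lebesgue_on S. F \<tau> = F' * (col_mat (g \<tau>) \<otimes>\<^sub>K 1\<^sub>m n)"
  proof eventually_elim
    case (elim \<tau>)
    then have carrier: "F \<tau> \<in> carrier_mat nr n" using F by simp
    have prod: "F' * (col_mat (g \<tau>) \<otimes>\<^sub>K 1\<^sub>m n) \<in> carrier_mat nr n"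
      by (rule mult_kronecker_one_carrier[OF F' dim])
    show ?case
    proof (rule eq_matI)
      fix i j assume "i < dim_row (F' * (col_mat (g \<tau>) \<otimes>\<^sub>K 1\<^sub>m n))"
        "j < dim_col (F' * (col_mat (g \<tau>) \<otimes>\<^sub>K 1\<^sub>m n))"
      with prod have ij: "i < nr" "j < n" by auto
      with elim have "F \<tau> $$ (i, j) = (\<Sum>k<K. c i j k * g \<tau> $ k)"
        by (simp add: vs)
      also have "\<dots> = (F' * (col_mat (g \<tau>) \<otimes>\<^sub>K 1\<^sub>m n)) $$ (i, j)"
        unfolding mult_kronecker_one_index[OF F' dim ij] using ij by (simp add: index)
      finally show "F \<tau> $$ (i, j) = (F' * (col_mat (g \<tau>) \<otimes>\<^sub>K 1\<^sub>m n)) $$ (i, j)" .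
    qed (use carrier prod in auto)
  qed
  with F' show ?thesis by blast
qed

section \<open>The constant function\<close>

lemma integral_deriv_test_function:
  assumes "test_function {a..b} \<psi>" "a \<le> b"
  shows "(\<integral>\<tau>. deriv \<psi> \<tau> \<partial>lebesgue_on {a..b}) = 0"
proof -
  have diff: "(deriv ^^ k) \<psi> differentiable_on UNIV" for k
    using assms(1) by (simp add: test_function_def)
  have "continuous_on {a..b} (deriv \<psi>)"
    \<comment> \<open>Taking \<open>k = 1\<close>, the derivative is itself differentiable, hence
      continuous and integrable on the compact interval.\<close>
    using differentiable_imp_continuous_on[OF diff[of 1]] continuous_on_subset by auto
  then have "integrable (lebesgue_on {a..b}) (deriv \<psi>)"
    by (rule continuous_imp_integrable_real)
  then have "(\<integral>\<tau>. deriv \<psi> \<tau> \<partial>lebesgue_on {a..b}) = integral {a..b} (deriv \<psi>)"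
    by (simp add: lebesgue_integral_eq_integral)
  also have "\<dots> = \<psi> b - \<psi> a"
  proof (intro integral_unique fundamental_theorem_of_calculus assms(2))
    fix x
    have "\<psi> differentiable at x"
      using diff[of 0] by (simp add: differentiable_on_def)
    then show "(\<psi> has_vector_derivative deriv \<psi> x) (at x within {a..b})"
      using DERIV_deriv_iff_real_differentiable has_field_derivative_at_within
        has_real_derivative_iff_has_vector_derivative by blast
  qed
  also have "\<dots> = 0"
  proof -
    \<comment> \<open>The support lies in the interior, so both boundary terms vanish.\<close>
    have "{x. \<psi> x \<noteq> 0} \<subseteq> {a<..<b}"
      using assms(1) closure_subset[of "{x. \<psi> x \<noteq> 0}"]
      by (auto simp: test_function_def)
    then have "\<psi> a = 0" "\<psi> b = 0" by auto
    then show ?thesis by simp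
  qed
  finally show ?thesis .
qed

text \<open>Integration by parts reduces to \<open>integral_deriv_test_function\<close>, and
  constants are integrable on compact sets because these have finite measure.\<close>

lemma has_weak_derivative_const:
  assumes "a \<le> b"
  shows "has_weak_derivative {a..b} (\<lambda>_. c) (\<lambda>_. 0)"
proof -
  have "integrable (lebesgue_on K) (\<lambda>_. c)" if "compact K" for K :: "real set"
  proof -
    have "finite_measure (lebesgue_on K)"
      using that lmeasurable_compact by (intro finite_measure_lebesgue_on)
    then show ?thesis by (rule finite_measure.integrable_const)
  qed
  then show ?thesis
    using assms by (auto simp: has_weak_derivative_def locally_integrable_def integral_deriv_test_function)
qed

section \<open>The representation on one interval\<close>

text \<open>The right-hand side of the theorem for a single interval. The body repeats that formula
  literally, so that unfolding it recovers the theorem.\<close>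

definition representable ::
  "real set \<Rightarrow> nat \<Rightarrow> nat \<Rightarrow> (real \<Rightarrow> real mat) \<Rightarrow> (real \<Rightarrow> real mat) \<Rightarrow> bool" where
  "representable S n m A C \<longleftrightarrow> (\<exists>(d::nat) (\<delta>::nat) (\<mu>::nat) f vphi phi M A' C'.
        d \<ge> 1 \<and> f \<in> H1_vec S d \<and> vphi \<in> L2_vec S \<delta> \<and> phi \<in> L2_vec S \<mu> \<and>
        M \<in> carrier_mat d (d + \<delta>) \<and>
        A' \<in> carrier_mat n ((d + \<delta> + \<mu>) * n) \<and> C' \<in> carrier_mat m ((d + \<delta> + \<mu>) * n) \<and>
        (let h = (\<lambda>\<tau>. vphi \<tau> @\<^sub>v f \<tau>); g = (\<lambda>\<tau>. phi \<tau> @\<^sub>v h \<tau>) in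
          (AE \<tau> in lebesgue_on S. A \<tau> = A' * (col_mat (g \<tau>) \<otimes>\<^sub>K 1\<^sub>m n)) \<and>
          (AE \<tau> in lebesgue_on S. C \<tau> = C' * (col_mat (g \<tau>) \<otimes>\<^sub>K 1\<^sub>m n)) \<and>
          (\<exists>f'. has_weak_derivative_vec S d f f' \<and>
             (AE \<tau> in lebesgue_on S. f' \<tau> = M *\<^sub>v h \<tau>)) \<and>
          sym_pos_def (d + \<delta> + \<mu>) (mat_integral S (d + \<delta> + \<mu>) (d + \<delta> + \<mu>)
            (\<lambda>\<tau>. col_mat (g \<tau>) * transpose_mat (col_mat (g \<tau>))))))"

lemma representable_imp_L2:
  assumes S: "S \<in> sets lebesgue"
    and A: "\<And>\<tau>. \<tau> \<in> S \<Longrightarrow> A \<tau> \<in> carrier_mat n n" and C: "\<And>\<tau>. \<tau> \<in> S \<Longrightarrow> C \<tau> \<in> carrier_mat m n"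
    and rep: "representable S n m A C"
  shows "A \<in> L2_mat S n n \<and> C \<in> L2_mat S m n"
proof -
  obtain d \<delta> \<mu> f vphi phi A' C' where *:
    "f \<in> H1_vec S d" "vphi \<in> L2_vec S \<delta>" "phi \<in> L2_vec S \<mu>"
    "A' \<in> carrier_mat n ((d + \<delta> + \<mu>) * n)" "C' \<in> carrier_mat m ((d + \<delta> + \<mu>) * n)"
    "AE \<tau> in lebesgue_on S. A \<tau> = A' * (col_mat (phi \<tau> @\<^sub>v vphi \<tau> @\<^sub>v f \<tau>) \<otimes>\<^sub>K 1\<^sub>m n)"
    "AE \<tau> in lebesgue_on S. C \<tau> = C' * (col_mat (phi \<tau> @\<^sub>v vphi \<tau> @\<^sub>v f \<tau>) \<otimes>\<^sub>K 1\<^sub>m n)"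
    using rep unfolding representable_def Let_def by blast
  have "(\<lambda>\<tau>. phi \<tau> @\<^sub>v vphi \<tau> @\<^sub>v f \<tau>) \<in> L2_vec S (\<mu> + (\<delta> + d))"
    using *(1-3) by (intro L2_vec_append) (auto simp: H1_vec_def)
  \<comment> \<open>The blocks are stacked in the order \<open>\<mu>\<close>,
    \<open>\<delta>\<close>, \<open>d\<close>, while the dimension is written as
    \<open>d + \<delta> + \<mu>\<close>.\<close>
  then have g: "(\<lambda>\<tau>. phi \<tau> @\<^sub>v vphi \<tau> @\<^sub>v f \<tau>) \<in> L2_vec S (d + \<delta> + \<mu>)"
    by (simp add: add_ac)
  show ?thesis
    using L2_mat_of_AE_representation[OF S A g *(4,6)] L2_mat_of_AE_representation[OF S C g *(5,7)]
    by blast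
qed

text \<open>The matrix entries chosen by \<open>ae_independent_extension\<close> form
  \<open>phi\<close>, and the constant 1 is \<open>f\<close>. Independence gives the Gram condition,
  and the span property gives both coefficient matrices.\<close>

lemma L2_imp_representable:
  fixes a b :: real
  assumes ab: "a < b" and A: "A \<in> L2_mat {a..b} n n" and C: "C \<in> L2_mat {a..b} m n"
  shows "representable {a..b} n m A C"
proof -
  let ?S = "{a..b}"
  let ?L = "lebesgue_on ?S"
  have one: "square_integrable ?L (\<lambda>_. c)" for c
    by (simp add: square_integrable_def continuous_imp_integrable_real)
  define us where "us = [\<lambda>\<tau>. A \<tau> $$ (i, j). i \<leftarrow> [0..<n], j \<leftarrow> [0..<n]] @
    [\<lambda>\<tau>. C \<tau> $$ (i, j). i \<leftarrow> [0..<m], j \<leftarrow> [0..<n]]"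
  have us: "set us = {\<lambda>\<tau>. A \<tau> $$ (i, j) |i j. i < n \<and> j < n} \<union> {\<lambda>\<tau>. C \<tau> $$ (i, j) |i j. i < m \<and> j < n}"
    by (auto simp: us_def)
  have "ae_independent ?L [\<lambda>_. 1]"
    \<comment> \<open>Since \<open>a < b\<close>, the interval has positive measure.\<close>
    using ab by (intro ae_independent_one) (simp add: emeasure_restrict_space)
  then obtain vs where vs: "set vs \<subseteq> set us" "ae_independent ?L (vs @ [\<lambda>_. 1])"
    "set us \<subseteq> ae_span ?L (vs @ [\<lambda>_. 1])"
    using ae_independent_extension by blast
  define \<mu> where "\<mu> = length vs"
  define phi where "phi \<tau> = Matrix.vec \<mu> (\<lambda>k. (vs ! k) \<tau>)" for \<tau>
  define vphi where "vphi \<tau> = (0\<^sub>v 0 :: real Matrix.vec)" for \<tau> :: real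
  define f where "f \<tau> = Matrix.vec 1 (\<lambda>_. 1 :: real)" for \<tau> :: real
  define g where "g \<tau> = phi \<tau> @\<^sub>v vphi \<tau> @\<^sub>v f \<tau>" for \<tau>
  have "square_integrable ?L v" if "v \<in> set us" for v
    using that A C unfolding us by (auto simp: L2_mat_iff)
  then have phi: "phi \<in> L2_vec ?S \<mu>"
    using vs(1) by (auto simp: L2_vec_iff phi_def \<mu>_def subset_eq)
  have vphi: "vphi \<in> L2_vec ?S 0"
    by (simp add: L2_vec_iff vphi_def)
  have f: "f \<in> L2_vec ?S 1"
    using one by (simp add: L2_vec_iff f_def)
  have weak: "has_weak_derivative_vec ?S 1 f (\<lambda>_. 0\<^sub>v 1)"
    using has_weak_derivative_const[of a b 1] ab
    by (simp add: has_weak_derivative_vec_def f_def)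
  have "(\<lambda>_. 0\<^sub>v 1) \<in> L2_vec ?S 1"
    using one by (simp add: L2_vec_iff)
  with f weak have H1: "f \<in> H1_vec ?S 1"
    unfolding H1_vec_def by blast
  \<comment> \<open>With an empty middle block, \<open>g\<close> lists the selected entries and then
    the constant. The dimension stays in the form \<open>1 + 0 + \<mu>\<close> to match
    \<open>d + \<delta> + \<mu>\<close> for \<open>d = 1\<close> and
    \<open>\<delta> = 0\<close>.\<close>
  have g_index: "g \<tau> $ k = ((vs @ [\<lambda>_. 1]) ! k) \<tau>" if "k < 1 + 0 + \<mu>" for \<tau> k
    using that by (auto simp: g_def phi_def vphi_def f_def \<mu>_def nth_append)
  have g_dim: "g \<tau> \<in> carrier_vec (1 + 0 + \<mu>)" for \<tau>
    by (rule carrier_vecI) (simp add: g_def phi_def vphi_def f_def)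
  have len: "length (vs @ [\<lambda>_. 1]) = 1 + 0 + \<mu>" by (simp add: \<mu>_def)
  have "g \<in> L2_vec ?S (\<mu> + (0 + 1))"
    unfolding g_def by (intro L2_vec_append phi vphi f)
  then have g: "g \<in> L2_vec ?S (1 + 0 + \<mu>)" by simp
  obtain A' where A': "A' \<in> carrier_mat n ((1 + 0 + \<mu>) * n)"
    "AE \<tau> in ?L. A \<tau> = A' * (col_mat (g \<tau>) \<otimes>\<^sub>K 1\<^sub>m n)"
    using mat_AE_representation[of ?S A n n, OF _ len g_index g_dim] A vs(3)
    unfolding us L2_mat_iff by blast
  obtain C' where C': "C' \<in> carrier_mat m ((1 + 0 + \<mu>) * n)"
    "AE \<tau> in ?L. C \<tau> = C' * (col_mat (g \<tau>) \<otimes>\<^sub>K 1\<^sub>m n)"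
    using mat_AE_representation[of ?S C m n, OF _ len g_index g_dim] C vs(3)
    unfolding us L2_mat_iff by blast
  \<comment> \<open>With \<open>M\<close> the zero matrix, the differential equation says that the
    constant \<open>f\<close> has weak derivative 0.\<close>
  have "AE \<tau> in ?L. 0\<^sub>v 1 = 0\<^sub>m 1 (1 + 0) *\<^sub>v (vphi \<tau> @\<^sub>v f \<tau>)"
    by (intro AE_I2 eq_vecI) (auto simp: vphi_def f_def scalar_prod_def)
  with weak have deriv: "\<exists>f'. has_weak_derivative_vec ?S 1 f f' \<and>
      (AE \<tau> in ?L. f' \<tau> = 0\<^sub>m 1 (1 + 0) *\<^sub>v (vphi \<tau> @\<^sub>v f \<tau>))"
    by blast
  have gram: "sym_pos_def (1 + 0 + \<mu>) (mat_integral ?S (1 + 0 + \<mu>) (1 + 0 + \<mu>)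
      (\<lambda>\<tau>. col_mat (g \<tau>) * transpose_mat (col_mat (g \<tau>))))"
    by (rule gram_sym_pos_def[OF g len g_index g_dim vs(2)])
  show ?thesis
    unfolding representable_def Let_def
    by (rule exI[of _ 1], rule exI[of _ 0], rule exI[of _ \<mu>], rule exI[of _ f],
        rule exI[of _ vphi], rule exI[of _ phi], rule exI[of _ "0\<^sub>m 1 (1 + 0)"],
        rule exI[of _ A'], rule exI[of _ C'], intro conjI)
      (use H1 vphi phi A' C' deriv gram in \<open>simp_all only: g_def zero_carrier_mat le_refl\<close>)
qed

text \<open>The intervals do not interact, so the equivalence is proved for each \<open>i\<close>
  separately.\<close>

theorem proposition1:
  fixes n m \<nu> :: nat
    and r :: "nat \<Rightarrow> real"
    and I :: "nat \<Rightarrow> real set"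
    and A C :: "nat \<Rightarrow> real \<Rightarrow> real mat"
  assumes "n \<ge> 1" and "m \<ge> 1" and "\<nu> \<ge> 1"
    and "r 0 = 0" and "\<And>i. i < \<nu> \<Longrightarrow> r i < r (Suc i)"
    and "\<And>i. i \<in> {1..\<nu>} \<Longrightarrow> I i = {- r i .. - r (i - 1)}"
    and "\<And>i \<tau>. i \<in> {1..\<nu>} \<Longrightarrow> \<tau> \<in> I i \<Longrightarrow> A i \<tau> \<in> carrier_mat n n"
    and "\<And>i \<tau>. i \<in> {1..\<nu>} \<Longrightarrow> \<tau> \<in> I i \<Longrightarrow> C i \<tau> \<in> carrier_mat m n"
  shows "(\<forall>i\<in>{1..\<nu>}. A i \<in> L2_mat (I i) n n \<and> C i \<in> L2_mat (I i) m n) \<longleftrightarrow>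
    (\<forall>i\<in>{1..\<nu>}. \<exists>(d::nat) (\<delta>::nat) (\<mu>::nat) f vphi phi M A' C'.
        d \<ge> 1 \<and> f \<in> H1_vec (I i) d \<and> vphi \<in> L2_vec (I i) \<delta> \<and> phi \<in> L2_vec (I i) \<mu> \<and>
        M \<in> carrier_mat d (d + \<delta>) \<and>
        A' \<in> carrier_mat n ((d + \<delta> + \<mu>) * n) \<and> C' \<in> carrier_mat m ((d + \<delta> + \<mu>) * n) \<and>
        (let h = (\<lambda>\<tau>. vphi \<tau> @\<^sub>v f \<tau>); g = (\<lambda>\<tau>. phi \<tau> @\<^sub>v h \<tau>) in
          (AE \<tau> in lebesgue_on (I i). A i \<tau> = A' * (col_mat (g \<tau>) \<otimes>\<^sub>K 1\<^sub>m n)) \<and>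
          (AE \<tau> in lebesgue_on (I i). C i \<tau> = C' * (col_mat (g \<tau>) \<otimes>\<^sub>K 1\<^sub>m n)) \<and>
          (\<exists>f'. has_weak_derivative_vec (I i) d f f' \<and>
             (AE \<tau> in lebesgue_on (I i). f' \<tau> = M *\<^sub>v h \<tau>)) \<and>
          sym_pos_def (d + \<delta> + \<mu>) (mat_integral (I i) (d + \<delta> + \<mu>) (d + \<delta> + \<mu>)
            (\<lambda>\<tau>. col_mat (g \<tau>) * transpose_mat (col_mat (g \<tau>))))))"
proof -
  have "A i \<in> L2_mat (I i) n n \<and> C i \<in> L2_mat (I i) m n \<longleftrightarrow> representable (I i) n m (A i) (C i)"
    if i: "i \<in> {1..\<nu>}" for i
  proof
    assume L2: "A i \<in> L2_mat (I i) n n \<and> C i \<in> L2_mat (I i) m n"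
    \<comment> \<open>Monotonicity is applied at \<open>i - 1\<close>, whose successor is
      \<open>i\<close> because \<open>i\<close> is at least 1; it makes the interval
      nondegenerate.\<close>
    have "r (i - 1) < r i"
      using assms(5)[of "i - 1"] i by (cases i) auto
    then show "representable (I i) n m (A i) (C i)"
      using L2 assms(6)[OF i] by (simp add: L2_imp_representable)
  next
    assume "representable (I i) n m (A i) (C i)"
    then show "A i \<in> L2_mat (I i) n n \<and> C i \<in> L2_mat (I i) m n"
      by (intro representable_imp_L2) (use assms(6-8) i in simp_all)
  qed
  then show ?thesis
    unfolding representable_def by simp
qed

end
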